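(* Let $N\ge 1$ and $n\ge 0$ be integers and let $b\ge 2$ be an integer with $b>n$. Define the multivariable differential operator $\vartheta_{N}:=x_0x_1\cdots x_{N-1}D_0 D_1 \cdots D_{N-1}$, where $D_i:=\frac{\partial}{\partial x_i}$. Then $$\vartheta_{N}^n = \sum_{0\le k_0,k_1,\ldots, k_{N-1}\leq n}\genfrac\{\}{0pt}{}{n}{k}_{b}\ \prod_{i=0}^{N-1}x_i^{k_i}D_i^{k_{i}},$$ where in each term $k:=\sum_{i=0}^{N-1}k_ib^i$.
   Context: The identity is between differential operators (acting, e.g., on smooth functions or polynomials in $x_0,\dots,x_{N-1}$). $\genfrac\{\}{0pt}{}{n}{m}$ denotes the ordinary Stirling number of the second kind. For $k=\sum_{i=0}^{N-1}k_ib^i$ with digits $0\le k_i\le b-1$ (written with exactly $N$ digits, leading zeros allowed), the base-$b$ Stirling number is $\genfrac\{\}{0pt}{}{n}{k}_{b}:=\prod_{i=0}^{N-1}\genfrac\{\}{0pt}{}{n}{k_i}$. *)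

theory Defs
  imports "HOL-Analysis.Analysis" "HOL-Combinatorics.Stirling"
begin

text \<open>
  A point of \<open>\<real>\<^sup>N\<close> is represented by \<open>x :: nat \<Rightarrow> real\<close>, of which only the coordinates
  \<open>x 0, \<dots>, x (N - 1)\<close> matter: functions on \<open>\<real>\<^sup>N\<close> are those \<open>f :: (nat \<Rightarrow> real) \<Rightarrow> real\<close>
  that depend on these coordinates only.
\<close>

type_synonym fn = "(nat \<Rightarrow> real) \<Rightarrow> real"
type_synonym diff_op = "fn \<Rightarrow> fn"

definition depends_on_first :: "nat \<Rightarrow> fn \<Rightarrow> bool" where
  "depends_on_first N f \<longleftrightarrow> (\<forall>x y. (\<forall>i<N. x i = y i) \<longrightarrow> f x = f y)"

definition D :: "nat \<Rightarrow> diff_op" where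
  "D i f = (\<lambda>x. deriv (\<lambda>t. f (x(i := t))) (x i))"

definition X :: "nat \<Rightarrow> diff_op" where
  "X i f = (\<lambda>x. x i * f x)"

text \<open>
  \<open>C\<^sup>\<infinity>(\<real>\<^sup>N)\<close>: all iterated partial derivatives, in any order, exist and are continuous.
  As \<open>deriv\<close> is total, existence is required explicitly.  For functions depending only on
  the first \<open>N\<close> coordinates, continuity in the product topology on \<open>nat \<Rightarrow> real\<close> is the
  usual continuity on \<open>\<real>\<^sup>N\<close>.
\<close>

definition smooth_functions :: "nat \<Rightarrow> fn set" where
  "smooth_functions N = {f. depends_on_first N f \<and>
     (\<forall>js. set js \<subseteq> {..<N} \<longrightarrow>
        continuous_on UNIV (foldr D js f) \<and>
        (\<forall>i<N. \<forall>x. (\<lambda>t. foldr D js f (x(i := t))) field_differentiable at (x i)))}"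

text \<open>The composition \<open>F 0 \<circ> F 1 \<circ> \<dots> \<circ> F (N - 1)\<close>, written as a product of operators.\<close>

primrec op_prod :: "nat \<Rightarrow> (nat \<Rightarrow> diff_op) \<Rightarrow> diff_op" where
  "op_prod 0 F = id"
| "op_prod (Suc N) F = op_prod N F \<circ> F N"

definition vartheta :: "nat \<Rightarrow> diff_op" where
  "vartheta N = op_prod N X \<circ> op_prod N D"

text \<open>
  The number of digits \<open>N\<close> is a parameter, since a leading zero contributes the factor
  \<open>Stirling n 0\<close>, which is \<open>0\<close> for \<open>n > 0\<close>.
\<close>

definition base_Stirling :: "nat \<Rightarrow> nat \<Rightarrow> nat \<Rightarrow> nat \<Rightarrow> nat" where
  "base_Stirling N b n k = (\<Prod>i<N. Stirling n (k div b ^ i mod b))"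

end

theory Submission
  imports Defs
begin

text \<open>
  On smooth functions the operators \<open>x\<^sub>i\<close>, \<open>D\<^sub>i\<close> commute with \<open>x\<^sub>j\<close>, \<open>D\<^sub>j\<close> for \<open>i \<noteq> j\<close> (for \<open>D\<^sub>i\<close> and
  \<open>D\<^sub>j\<close> this is Schwarz's theorem), so the \<open>n\<close>-th power of the operator is the product of the
  \<open>(x\<^sub>i D\<^sub>i)\<^sup>n\<close>.  Each factor is the sum of the \<open>Stirling n k \<cdot> x\<^sub>i\<^sup>k D\<^sub>i\<^sup>k\<close>, and expanding the product of
  these sums gives the claim, since \<open>b > n\<close> makes the \<open>k\<^sub>i\<close> the base-\<open>b\<close> digits of \<open>k\<close>.
\<close>

section \<open>Symmetry of mixed partial derivatives\<close>

text \<open>The mean value theorem is applied twice: to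
  \<open>\<lambda>s. g s (b + h) - g s b\<close>, then to \<open>g1 \<xi>\<close>. The left-hand
  side is symmetric in the two variables, so it can be evaluated in either order of
  differentiation.\<close>

lemma second_difference_mean_value:
  fixes g g1 g12 :: "real \<Rightarrow> real \<Rightarrow> real"
  assumes g1: "\<And>s t. ((\<lambda>s. g s t) has_real_derivative g1 s t) (at s)"
    and g12: "\<And>s t. ((\<lambda>t. g1 s t) has_real_derivative g12 s t) (at t)"
    and h: "h > 0"
  obtains \<xi> \<eta> where "a < \<xi>" "\<xi> < a + h" "b < \<eta>" "\<eta> < b + h"
    "g (a + h) (b + h) - g (a + h) b - g a (b + h) + g a b = h * h * g12 \<xi> \<eta>"
proof -
  have "\<exists>\<xi>. a < \<xi> \<and> \<xi> < a + h \<and>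
      (g (a + h) (b + h) - g (a + h) b) - (g a (b + h) - g a b)
        = (a + h - a) * (g1 \<xi> (b + h) - g1 \<xi> b)"
    by (rule MVT2) (use h in \<open>auto intro!: DERIV_diff g1\<close>)
  then obtain \<xi> where \<xi>: "a < \<xi>" "\<xi> < a + h"
    "(g (a + h) (b + h) - g (a + h) b) - (g a (b + h) - g a b) = h * (g1 \<xi> (b + h) - g1 \<xi> b)"
    by auto
  have "\<exists>\<eta>. b < \<eta> \<and> \<eta> < b + h \<and> g1 \<xi> (b + h) - g1 \<xi> b = (b + h - b) * g12 \<xi> \<eta>"
    by (rule MVT2) (use h in \<open>auto intro!: g12\<close>)
  then obtain \<eta> where "b < \<eta>" "\<eta> < b + h" "g1 \<xi> (b + h) - g1 \<xi> b = h * g12 \<xi> \<eta>"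
    by auto
  with \<xi> show thesis
    by (intro that[of \<xi> \<eta>]) auto
qed

text \<open>Schwarz's theorem. The second difference over a small square is \<open>h * h\<close>
  times a value of \<open>g12\<close> and also times a value of \<open>g21\<close>, both taken near
  \<open>(a, b)\<close>; continuity there forces the limits to agree.\<close>

lemma mixed_partial_derivatives_eq:
  fixes g g1 g2 g12 g21 :: "real \<Rightarrow> real \<Rightarrow> real"
  assumes g1: "\<And>s t. ((\<lambda>s. g s t) has_real_derivative g1 s t) (at s)"
    and g12: "\<And>s t. ((\<lambda>t. g1 s t) has_real_derivative g12 s t) (at t)"
    and g2: "\<And>s t. ((\<lambda>t. g s t) has_real_derivative g2 s t) (at t)"
    and g21: "\<And>s t. ((\<lambda>s. g2 s t) has_real_derivative g21 s t) (at s)"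
    and cont12: "isCont (\<lambda>p. g12 (fst p) (snd p)) (a, b)"
    and cont21: "isCont (\<lambda>p. g21 (fst p) (snd p)) (a, b)"
  shows "g12 a b = g21 a b"
proof (rule ccontr)
  \<comment> \<open>Half the supposed gap: a common value within \<open>e\<close> of both numbers
    would make the gap less than itself.\<close>
  define e where "e = \<bar>g12 a b - g21 a b\<bar> / 2"
  assume "g12 a b \<noteq> g21 a b"
  then have e: "e > 0"
    by (simp add: e_def)
  obtain d1 where d1: "d1 > 0" "\<And>p. dist p (a, b) < d1 \<Longrightarrow> dist (g12 (fst p) (snd p)) (g12 a b) < e"
    using cont12 e by (auto simp: continuous_at_eps_delta)
  obtain d2 where d2: "d2 > 0" "\<And>p. dist p (a, b) < d2 \<Longrightarrow> dist (g21 (fst p) (snd p)) (g21 a b) < e"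
    using cont21 e by (auto simp: continuous_at_eps_delta)
  define h where "h = min d1 d2 / 2"
  have h: "h > 0" "2 * h \<le> d1" "2 * h \<le> d2"
    using d1(1) d2(1) by (auto simp: h_def)
  have near: "dist (s, t) (a, b) < 2 * h" if "a < s" "s < a + h" "b < t" "t < b + h" for s t
    using sqrt_sum_squares_le_sum_abs[of "s - a" "t - b"] that
    by (simp add: dist_Pair_Pair dist_real_def)
  obtain s t where st: "a < s" "s < a + h" "b < t" "t < b + h"
    "g (a + h) (b + h) - g (a + h) b - g a (b + h) + g a b = h * h * g12 s t"
    using second_difference_mean_value[OF g1 g12 h(1)] by metis
  obtain t' s' where st': "b < t'" "t' < b + h" "a < s'" "s' < a + h"
    "g (a + h) (b + h) - g a (b + h) - g (a + h) b + g a b = h * h * g21 s' t'"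
    \<comment> \<open>The same second difference with the roles of the variables exchanged.\<close>
    using second_difference_mean_value[of "\<lambda>t s. g s t" "\<lambda>t s. g2 s t" "\<lambda>t s. g21 s t", OF g2 g21 h(1)]
    by metis
  have "h * h * g12 s t = h * h * g21 s' t'"
    using st(5) st'(5) by linarith
  then have "g12 s t = g21 s' t'"
    using h(1) by simp
  moreover have "\<bar>g12 s t - g12 a b\<bar> < e"
    using d1(2)[of "(s, t)"] near[OF st(1-4)] h by (simp add: dist_real_def)
  moreover have "\<bar>g21 s' t' - g21 a b\<bar> < e"
    using d2(2)[of "(s', t')"] near[OF st'(3,4,1,2)] h by (simp add: dist_real_def)
  ultimately show False
    unfolding e_def by (simp add: abs_if split: if_splits)
qed

section \<open>The space of smooth functions\<close>

text \<open>A set \<open>T\<close> closed under the \<open>D i\<close> contains every iterated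
  derivative of its members, so regularity need only be checked on \<open>T\<close> itself. This
  spares the later closure proofs an induction over lists of derivatives.\<close>

lemma smooth_functions_coinduct:
  assumes "f \<in> T"
    and "\<And>g. g \<in> T \<Longrightarrow> depends_on_first N g"
    and "\<And>g. g \<in> T \<Longrightarrow> continuous_on UNIV g"
    and "\<And>g i x. g \<in> T \<Longrightarrow> i < N \<Longrightarrow> (\<lambda>t. g (x(i := t))) field_differentiable at (x i)"
    and "\<And>g i. g \<in> T \<Longrightarrow> i < N \<Longrightarrow> D i g \<in> T"
  shows "f \<in> smooth_functions N"
proof -
  have "foldr D js f \<in> T" if "set js \<subseteq> {..<N}" for js
    using that by (induction js) (auto simp: assms)
  then show ?thesis
    using assms by (auto simp: smooth_functions_def)
qed

lemma smooth_functions_D: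
  assumes "f \<in> smooth_functions N" "i < N"
  shows "D i f \<in> smooth_functions N"
proof -
  have f: "depends_on_first N f"
    and js: "\<And>js. set js \<subseteq> {..<N} \<Longrightarrow> continuous_on UNIV (foldr D js f) \<and>
        (\<forall>i<N. \<forall>x. (\<lambda>t. foldr D js f (x(i := t))) field_differentiable at (x i))"
    using assms(1) by (auto simp: smooth_functions_def)
  have "D i f x = D i f y" if "\<forall>k<N. x k = y k" for x y
  proof -
    have "f (x(i := t)) = f (y(i := t))" for t
      using f that by (simp add: depends_on_first_def)
    then show ?thesis
      using that assms(2) by (simp add: D_def)
  qed
  then have "depends_on_first N (D i f)"
    by (simp add: depends_on_first_def)
  then show ?thesis
    \<comment> \<open>\<open>foldr\<close> applies the last list entry first, so derivatives
      \<open>js\<close> of \<open>D i f\<close> are the derivatives \<open>js @ [i]\<close> of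
      \<open>f\<close>.\<close>
    using js[of "_ @ [i]"] assms(2) by (auto simp: smooth_functions_def)
qed

lemma smooth_functions_depends:
  "f \<in> smooth_functions N \<Longrightarrow> depends_on_first N f"
  by (simp add: smooth_functions_def)

lemma smooth_functions_continuous:
  "f \<in> smooth_functions N \<Longrightarrow> continuous_on UNIV f"
  unfolding smooth_functions_def by (auto dest!: spec[of _ "[]"])

lemma smooth_functions_DERIV:
  assumes "f \<in> smooth_functions N" "i < N"
  shows "((\<lambda>t. f (x(i := t))) has_real_derivative D i f (x(i := s))) (at s)"
proof -
  have "\<forall>i<N. \<forall>x. (\<lambda>t. f (x(i := t))) field_differentiable at (x i)"
    using assms(1) unfolding smooth_functions_def by (auto dest!: spec[of _ "[]"])
  \<comment> \<open>The definition speaks only of the base point's own coordinate, so the base point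
    is moved to \<open>x(i := s)\<close> to reach an arbitrary \<open>s\<close>.\<close>
  then have "(\<lambda>t. f ((x(i := s))(i := t))) field_differentiable at ((x(i := s)) i)"
    using assms(2) by blast
  then show ?thesis
    by (simp add: D_def DERIV_deriv_iff_field_differentiable)
qed

lemma smooth_functions_DERIV_at:
  assumes "f \<in> smooth_functions N" "i < N"
  shows "((\<lambda>t. f (x(i := t))) has_real_derivative D i f x) (at (x i))"
  using smooth_functions_DERIV[OF assms, of x "x i"] by simp

lemma D_eqI:
  assumes "\<And>x. ((\<lambda>t. f (x(i := t))) has_real_derivative g x) (at (x i))"
  shows "D i f = g"
  using DERIV_imp_deriv[OF assms] by (auto simp: D_def)

lemma D_lincomb:
  assumes "f \<in> smooth_functions N" "g \<in> smooth_functions N" "i < N"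
  shows "D i (\<lambda>x. c * f x + d * g x) = (\<lambda>x. c * D i f x + d * D i g x)"
  using assms by (intro D_eqI DERIV_add DERIV_cmult smooth_functions_DERIV_at[where N = N])

text \<open>The product rule, arranged so that the result is again \<open>X i\<close> of a smooth
  function plus a linear combination of smooth functions.\<close>

lemma D_X_add:
  assumes "f \<in> smooth_functions N" "g \<in> smooth_functions N" "j < N"
  shows "D j (\<lambda>x. X i f x + g x) =
    (\<lambda>x. X i (D j f) x + (1 * D j g x + (if i = j then 1 else 0) * f x))"
proof (rule D_eqI)
  fix x
  have "((\<lambda>t. (x(j := t)) i) has_real_derivative (if i = j then 1 else 0)) (at (x j))"
    by (cases "i = j") auto
  from DERIV_add[OF DERIV_mult[OF this smooth_functions_DERIV_at[OF assms(1,3), of x]]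
      smooth_functions_DERIV_at[OF assms(2,3), of x]]
  show "((\<lambda>t. X i f (x(j := t)) + g (x(j := t))) has_real_derivative
      X i (D j f) x + (1 * D j g x + (if i = j then 1 else 0) * f x)) (at (x j))"
    by (simp add: X_def algebra_simps)
qed

lemma smooth_functions_zero: "(\<lambda>x. 0) \<in> smooth_functions N"
  by (rule smooth_functions_coinduct[where T = "{\<lambda>x. 0}"])
     (auto simp: depends_on_first_def D_def)

lemma smooth_functions_lincomb:
  assumes "f \<in> smooth_functions N" "g \<in> smooth_functions N"
  shows "(\<lambda>x. c * f x + d * g x) \<in> smooth_functions N"
proof (rule smooth_functions_coinduct)
  let ?T = "{\<lambda>x. c * f x + d * g x | f g. f \<in> smooth_functions N \<and> g \<in> smooth_functions N}"
  show "(\<lambda>x. c * f x + d * g x) \<in> ?T"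
    using assms by blast
  fix u assume "u \<in> ?T"
  then obtain f g where u: "u = (\<lambda>x. c * f x + d * g x)"
    and fg: "f \<in> smooth_functions N" "g \<in> smooth_functions N"
    by blast
  show "depends_on_first N u"
    using fg[THEN smooth_functions_depends] unfolding u depends_on_first_def by metis
  show "continuous_on UNIV u"
    unfolding u by (intro continuous_intros smooth_functions_continuous[OF fg(1)]
      smooth_functions_continuous[OF fg(2)])
  show "(\<lambda>t. u (x(i := t))) field_differentiable at (x i)" if "i < N" for i x
    using DERIV_add[OF DERIV_cmult[OF smooth_functions_DERIV_at[OF fg(1) that, of x], of c]
        DERIV_cmult[OF smooth_functions_DERIV_at[OF fg(2) that, of x], of d]]
    unfolding u field_differentiable_def by blast
  show "D i u \<in> ?T" if "i < N" for i
    using smooth_functions_D[OF fg(1) that] smooth_functions_D[OF fg(2) that]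
    unfolding u D_lincomb[OF fg that] by blast
qed

text \<open>The product rule leaves a summand without the factor \<open>x i\<close>, so the
  functions \<open>X i f\<close> alone do not form a suitable coinduction set; the functions
  \<open>X i f + g\<close> do.\<close>

lemma smooth_functions_X_add:
  assumes "f \<in> smooth_functions N" "g \<in> smooth_functions N" "i < N"
  shows "(\<lambda>x. X i f x + g x) \<in> smooth_functions N"
proof (rule smooth_functions_coinduct)
  let ?T = "{\<lambda>x. X i f x + g x | f g. f \<in> smooth_functions N \<and> g \<in> smooth_functions N}"
  show "(\<lambda>x. X i f x + g x) \<in> ?T"
    using assms by blast
  fix u assume "u \<in> ?T"
  then obtain f g where u: "u = (\<lambda>x. X i f x + g x)"
    and fg: "f \<in> smooth_functions N" "g \<in> smooth_functions N"
    by blast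
  show "depends_on_first N u"
    using fg[THEN smooth_functions_depends] assms(3) unfolding u depends_on_first_def X_def by metis
  show "continuous_on UNIV u"
    unfolding u X_def by (intro continuous_intros smooth_functions_continuous[OF fg(1)]
      smooth_functions_continuous[OF fg(2)] continuous_on_product_coordinates)
  show "(\<lambda>t. u (x(j := t))) field_differentiable at (x j)" if "j < N" for j x
  proof -
    have "(\<lambda>t. (x(j := t)) i) field_differentiable at (x j)"
      by (cases "i = j") auto
    moreover have "(\<lambda>t. f (x(j := t))) field_differentiable at (x j)"
        "(\<lambda>t. g (x(j := t))) field_differentiable at (x j)"
      using smooth_functions_DERIV_at[OF fg(1) that] smooth_functions_DERIV_at[OF fg(2) that]
      unfolding field_differentiable_def by blast+
    ultimately show ?thesis
      unfolding u X_def by (intro field_differentiable_add field_differentiable_mult)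
  qed
  show "D j u \<in> ?T" if "j < N" for j
    using smooth_functions_D[OF fg(1) that]
      smooth_functions_lincomb[OF smooth_functions_D[OF fg(2) that] fg(1), of 1 "if i = j then 1 else 0"]
    unfolding u D_X_add[OF fg that] 
    by (intro CollectI exI[of _ "D j f"]
        exI[of _ "\<lambda>x. 1 * D j g x + (if i = j then 1 else 0) * f x"] conjI refl)
qed

lemma smooth_functions_X:
  assumes "f \<in> smooth_functions N" "i < N"
  shows "X i f \<in> smooth_functions N"
  using smooth_functions_X_add[OF assms(1) smooth_functions_zero assms(2)] by simp

lemma D_X:
  assumes "f \<in> smooth_functions N" "j < N"
  shows "D j (X i f) = (\<lambda>x. X i (D j f) x + (if i = j then f x else 0))"
  using D_X_add[OF assms(1) smooth_functions_zero assms(2), of i]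
  by (auto simp: D_def)

lemma X_X_commute: "X i (X j f) = X j (X i f)"
  by (auto simp: X_def)

lemma D_D_commute:
  assumes f: "f \<in> smooth_functions N" and i: "i < N" and j: "j < N"
  shows "D i (D j f) = D j (D i f)"
proof (cases "i = j")
  case False
  show ?thesis
  proof
    fix x :: "nat \<Rightarrow> real"
    \<comment> \<open>The coordinate plane through \<open>x\<close> in directions \<open>i\<close>
      and \<open>j\<close>. Since \<open>i \<noteq> j\<close>, the updates may be made in either
      order, so \<open>u\<close> can be differentiated along both axes.\<close>
    define p where "p = (\<lambda>s t. x(i := s, j := t))"
    have p': "p s t = x(j := t, i := s)" for s t
      using False by (auto simp: p_def)
    have along_i: "((\<lambda>s. u (p s t)) has_real_derivative D i u (p s t)) (at s)"
      if "u \<in> smooth_functions N" for u s t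
      unfolding p' by (rule smooth_functions_DERIV[OF that i])
    have along_j: "((\<lambda>t. u (p s t)) has_real_derivative D j u (p s t)) (at t)"
      if "u \<in> smooth_functions N" for u s t
      unfolding p_def by (rule smooth_functions_DERIV[OF that j])
    have "continuous_on UNIV (\<lambda>z. p (fst z) (snd z) k)" for k
      unfolding p_def by (cases "k = j"; cases "k = i") (auto intro!: continuous_intros)
    then have "continuous_on UNIV (\<lambda>z. p (fst z) (snd z))"
      by (rule continuous_on_coordinatewise_then_product)
    then have "continuous_on UNIV (\<lambda>z. u (p (fst z) (snd z)))" if "u \<in> smooth_functions N" for u
      using continuous_on_compose2[OF smooth_functions_continuous[OF that]] by blast
    then have cont: "isCont (\<lambda>z. u (p (fst z) (snd z))) (x i, x j)" if "u \<in> smooth_functions N" for u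
      using that by (simp add: continuous_on_eq_continuous_at)
    note [intro] = f i j smooth_functions_D
    have "D j (D i f) (p (x i) (x j)) = D i (D j f) (p (x i) (x j))"
      by (rule mixed_partial_derivatives_eq[where g = "\<lambda>s t. f (p s t)"])
         (rule along_i along_j cont; blast)+
    then show "D i (D j f) x = D j (D i f) x"
      by (simp add: p_def)
  qed
qed auto

section \<open>Linear operators and ordered products\<close>

text \<open>Linearity is required only on smooth functions, since \<open>deriv\<close> need not be
  additive elsewhere; preservation of that space is included so that such operators compose.\<close>

definition linear_op :: "nat \<Rightarrow> diff_op \<Rightarrow> bool" where
  "linear_op N F \<longleftrightarrow> (\<forall>f \<in> smooth_functions N. F f \<in> smooth_functions N) \<and>
    (\<forall>f \<in> smooth_functions N. \<forall>g \<in> smooth_functions N. \<forall>c d.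
       F (\<lambda>x. c * f x + d * g x) = (\<lambda>x. c * F f x + d * F g x))"

lemma linear_op_smooth:
  "linear_op N F \<Longrightarrow> f \<in> smooth_functions N \<Longrightarrow> F f \<in> smooth_functions N"
  by (simp add: linear_op_def)

lemma linear_op_lincomb:
  "linear_op N F \<Longrightarrow> f \<in> smooth_functions N \<Longrightarrow> g \<in> smooth_functions N \<Longrightarrow>
    F (\<lambda>x. c * f x + d * g x) = (\<lambda>x. c * F f x + d * F g x)"
  by (simp add: linear_op_def)

lemma linear_op_zero:
  assumes "linear_op N F"
  shows "F (\<lambda>x. 0) = (\<lambda>x. 0)"
  using linear_op_lincomb[OF assms smooth_functions_zero smooth_functions_zero, of 0 0] by simp

lemma smooth_functions_sum:
  assumes "finite K" "\<And>k. k \<in> K \<Longrightarrow> h k \<in> smooth_functions N"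
  shows "(\<lambda>x. \<Sum>k\<in>K. c k * h k x) \<in> smooth_functions N"
  using assms
proof (induction K rule: finite_induct)
  case (insert a K)
  then show ?case
    using smooth_functions_lincomb[of "h a" N "\<lambda>x. \<Sum>k\<in>K. c k * h k x" "c a" 1] by simp
qed (simp add: smooth_functions_zero)

lemma linear_op_sum:
  assumes F: "linear_op N F" and "finite K" "\<And>k. k \<in> K \<Longrightarrow> h k \<in> smooth_functions N"
  shows "F (\<lambda>x. \<Sum>k\<in>K. c k * h k x) = (\<lambda>x. \<Sum>k\<in>K. c k * F (h k) x)"
  using assms(2,3)
proof (induction K rule: finite_induct)
  case (insert a K)
  then have "(\<lambda>x. \<Sum>k\<in>K. c k * h k x) \<in> smooth_functions N"
    by (intro smooth_functions_sum) auto
  then show ?case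
    using insert linear_op_lincomb[OF F, of "h a" "\<lambda>x. \<Sum>k\<in>K. c k * h k x" "c a" 1] by simp
qed (simp add: linear_op_zero[OF F])

lemma linear_op_X: "i < N \<Longrightarrow> linear_op N (X i)"
  by (auto simp: linear_op_def smooth_functions_X) (auto simp: X_def algebra_simps)

lemma linear_op_D: "i < N \<Longrightarrow> linear_op N (D i)"
  by (simp add: linear_op_def smooth_functions_D D_lincomb)

lemma linear_op_comp: "linear_op N F \<Longrightarrow> linear_op N G \<Longrightarrow> linear_op N (F \<circ> G)"
  by (simp add: linear_op_def)

lemma linear_op_id: "linear_op N id"
  by (simp add: linear_op_def)

lemma linear_op_funpow: "linear_op N F \<Longrightarrow> linear_op N (F ^^ n)"
  by (induction n) (simp_all add: linear_op_id linear_op_comp)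

lemma linear_op_op_prod: "(\<And>i. i < M \<Longrightarrow> linear_op N (F i)) \<Longrightarrow> linear_op N (op_prod M F)"
  by (induction M) (simp_all add: linear_op_id linear_op_comp)

lemma op_prod_cong: "(\<And>i. i < M \<Longrightarrow> F i = G i) \<Longrightarrow> op_prod M F = op_prod M G"
  by (induction M) auto

lemma op_prod_commute:
  assumes "\<And>i. i < M \<Longrightarrow> linear_op N (G i)"
    and "\<And>i f. i < M \<Longrightarrow> f \<in> smooth_functions N \<Longrightarrow> F (G i f) = G i (F f)"
    and "f \<in> smooth_functions N"
  shows "F (op_prod M G f) = op_prod M G (F f)"
  using assms
proof (induction M arbitrary: f)
  case (Suc M)
  then show ?case
    by (simp add: linear_op_smooth)
qed simp

text \<open>The factor \<open>F M\<close> is moved past \<open>op_prod M G\<close> to meet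
  \<open>G M\<close>. Commutation is asked only for distinct indices, so that \<open>X i\<close> and
  \<open>D i\<close> qualify.\<close>

lemma op_prod_op_prod:
  assumes "\<And>i. i < M \<Longrightarrow> linear_op N (F i)" "\<And>i. i < M \<Longrightarrow> linear_op N (G i)"
    and "\<And>i j f. i < M \<Longrightarrow> j < M \<Longrightarrow> i \<noteq> j \<Longrightarrow> f \<in> smooth_functions N \<Longrightarrow> F i (G j f) = G j (F i f)"
    and "f \<in> smooth_functions N"
  shows "op_prod M F (op_prod M G f) = op_prod M (\<lambda>i. F i \<circ> G i) f"
  using assms
proof (induction M arbitrary: f)
  case (Suc M)
  have GM: "G M f \<in> smooth_functions N"
    using Suc.prems by (simp add: linear_op_smooth)
  then have FGM: "F M (G M f) \<in> smooth_functions N"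
    using Suc.prems by (simp add: linear_op_smooth)
  have "F M (op_prod M G (G M f)) = op_prod M G (F M (G M f))"
    by (rule op_prod_commute[where N = N]) (use Suc.prems GM in auto)
  moreover have "op_prod M F (op_prod M G (F M (G M f))) = op_prod M (\<lambda>i. F i \<circ> G i) (F M (G M f))"
    by (rule Suc.IH) (use Suc.prems FGM in auto)
  ultimately show ?case
    by (simp add: comp_def)
qed simp

lemma funpow_commute:
  assumes "linear_op N G" "\<And>f. f \<in> smooth_functions N \<Longrightarrow> F (G f) = G (F f)"
    and "f \<in> smooth_functions N"
  shows "F ((G ^^ n) f) = (G ^^ n) (F f)"
  using assms linear_op_smooth[OF linear_op_funpow[OF assms(1)]]
  by (induction n) auto

text \<open>Merging one more copy of the product, factor by factor, raises every exponent by
  one.\<close>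

lemma op_prod_funpow:
  assumes F: "\<And>i. i < M \<Longrightarrow> linear_op N (F i)"
    and comm: "\<And>i j f. i < M \<Longrightarrow> j < M \<Longrightarrow> i \<noteq> j \<Longrightarrow> f \<in> smooth_functions N \<Longrightarrow>
      F i (F j f) = F j (F i f)"
    and f: "f \<in> smooth_functions N"
  shows "(op_prod M F ^^ n) f = op_prod M (\<lambda>i. F i ^^ n) f"
proof (induction n)
  case 0
  show ?case
    by (induction M) auto
next
  case (Suc n)
  have "op_prod M F (op_prod M (\<lambda>i. F i ^^ n) f) = op_prod M (\<lambda>i. F i \<circ> F i ^^ n) f"
    by (rule op_prod_op_prod[where N = N])
       (auto intro!: F f linear_op_funpow funpow_commute[where N = N] comm)
  with Suc show ?case
    by (simp add: comp_def)
qed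

text \<open>Splits off the value at \<open>M\<close>, the index of the factor that
  \<open>op_prod (Suc M)\<close> applies first, to match its recursion.\<close>

lemma sum_PiE_lessThan_Suc:
  "(\<Sum>k \<in> {..<Suc M} \<rightarrow>\<^sub>E A. h k) = (\<Sum>k \<in> {..<M} \<rightarrow>\<^sub>E A. \<Sum>y\<in>A. h (k(M := y)))"
proof -
  have "inj_on (\<lambda>(y, k). k(M := y)) (A \<times> ({..<M} \<rightarrow>\<^sub>E A))"
    using inj_combinator[of M "{..<M}" "\<lambda>_. A"] by simp
  then have "(\<Sum>k \<in> {..<Suc M} \<rightarrow>\<^sub>E A. h k) = (\<Sum>(y, k) \<in> A \<times> ({..<M} \<rightarrow>\<^sub>E A). h (k(M := y)))"
    by (simp add: lessThan_Suc PiE_insert_eq sum.reindex case_prod_unfold)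
  also have "\<dots> = (\<Sum>y\<in>A. \<Sum>k \<in> {..<M} \<rightarrow>\<^sub>E A. h (k(M := y)))"
    by (simp add: sum.cartesian_product)
  also have "\<dots> = (\<Sum>k \<in> {..<M} \<rightarrow>\<^sub>E A. \<Sum>y\<in>A. h (k(M := y)))"
    by (rule sum.swap)
  finally show ?thesis .
qed

text \<open>Distributivity for compositions of operators: the sum produced by \<open>E M\<close> is
  pulled through the remaining factors by their linearity.\<close>

lemma op_prod_sum:
  assumes A: "finite A"
    and "\<And>i k. i < M \<Longrightarrow> k \<in> A \<Longrightarrow> linear_op N (G i k)"
    and "\<And>i f. i < M \<Longrightarrow> f \<in> smooth_functions N \<Longrightarrow> E i f = (\<lambda>x. \<Sum>k\<in>A. c k * G i k f x)"
    and "f \<in> smooth_functions N"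
  shows "op_prod M E f =
    (\<lambda>x. \<Sum>k \<in> {..<M} \<rightarrow>\<^sub>E A. (\<Prod>i<M. c (k i)) * op_prod M (\<lambda>i. G i (k i)) f x)"
  using assms(2-)
proof (induction M arbitrary: f)
  case (Suc M)
  have GM: "G M y f \<in> smooth_functions N" if "y \<in> A" for y
    using that Suc.prems by (simp add: linear_op_smooth)
  have EM: "E M f = (\<lambda>x. \<Sum>y\<in>A. c y * G M y f x)"
    using Suc.prems by simp
  have IH: "op_prod M E (E M f) =
      (\<lambda>x. \<Sum>k \<in> {..<M} \<rightarrow>\<^sub>E A. (\<Prod>i<M. c (k i)) * op_prod M (\<lambda>i. G i (k i)) (E M f) x)"
    using Suc.prems smooth_functions_sum[OF A GM] by (intro Suc.IH) (auto simp: EM)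
  have lin: "op_prod M (\<lambda>i. G i (k i)) (E M f) =
      (\<lambda>x. \<Sum>y\<in>A. c y * op_prod M (\<lambda>i. G i (k i)) (G M y f) x)"
    if "k \<in> {..<M} \<rightarrow>\<^sub>E A" for k
  proof -
    have "linear_op N (G i (k i))" if "i < M" for i
      using that PiE_mem[OF \<open>k \<in> _\<close>, of i] by (intro Suc.prems(1)) auto
    then show ?thesis
      unfolding EM by (intro linear_op_sum[OF linear_op_op_prod A GM])
  qed
  \<comment> \<open>Factors with index below \<open>M\<close> do not see the value chosen at
    \<open>M\<close>.\<close>
  have upd: "op_prod M (\<lambda>i. G i ((k(M := y)) i)) = op_prod M (\<lambda>i. G i (k i))" for k y
    by (rule op_prod_cong) auto
  have upd': "(\<Prod>i<M. c ((k(M := y)) i)) = (\<Prod>i<M. c (k i))" for k y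
    by (rule prod.cong) auto
  show ?case
    unfolding op_prod.simps comp_def IH sum_PiE_lessThan_Suc prod.lessThan_Suc upd upd'
    by (auto simp: lin sum_distrib_left mult.assoc intro!: ext sum.cong)
qed (simp add: PiE_empty_domain)

section \<open>The one-variable expansion and base-\<open>b\<close> digits\<close>

lemma X_funpow: "(X i ^^ k) f = (\<lambda>x. x i ^ k * f x)"
  by (induction k) (auto simp: X_def)

text \<open>Iterating the commutation relation \<open>D X = X D + 1\<close> gives
  \<open>X D X^k = k X^k + X^(k+1) D\<close>.\<close>

lemma D_X_funpow:
  assumes "f \<in> smooth_functions N" "i < N"
  shows "X i (D i ((X i ^^ k) f)) = (\<lambda>x. real k * (X i ^^ k) f x + (X i ^^ Suc k) (D i f) x)"
proof (induction k)
  case (Suc k)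
  have "(X i ^^ k) f \<in> smooth_functions N"
    using assms by (intro linear_op_smooth[OF linear_op_funpow] linear_op_X)
  then have "X i (D i ((X i ^^ Suc k) f)) =
      (\<lambda>x. x i * X i (D i ((X i ^^ k) f)) x + x i * (X i ^^ k) f x)"
    using D_X[OF _ assms(2), of "(X i ^^ k) f" i] by (simp add: X_def[of i] algebra_simps)
  then show ?case
    unfolding Suc by (simp only: X_funpow) (simp add: algebra_simps)
qed (simp add: X_def)

text \<open>Applying \<open>X D\<close> to \<open>X^k D^k\<close> gives
  \<open>k X^k D^k + X^(k+1) D^(k+1)\<close>, so the coefficients obey the recurrence of the
  Stirling numbers of the second kind.\<close>

lemma X_D_funpow:
  assumes f: "f \<in> smooth_functions N" and i: "i < N"
  shows "((X i \<circ> D i) ^^ n) f =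
    (\<lambda>x. \<Sum>k\<le>n. real (Stirling n k) * ((X i ^^ k) \<circ> (D i ^^ k)) f x)"
proof (induction n)
  case (Suc n)
  define W where "W = (\<lambda>k. ((X i ^^ k) \<circ> (D i ^^ k)) f)"
  have Dk: "(D i ^^ k) f \<in> smooth_functions N" for k
    by (intro linear_op_smooth[OF linear_op_funpow] linear_op_D f i)
  have W: "W k \<in> smooth_functions N" for k
    using linear_op_smooth[OF linear_op_funpow[OF linear_op_X[OF i]] Dk] by (simp add: W_def)
  have XD: "linear_op N (X i \<circ> D i)"
    by (intro linear_op_comp linear_op_X linear_op_D i)
  have step: "(X i \<circ> D i) (W k) = (\<lambda>x. real k * W k x + W (Suc k) x)" for k
    using D_X_funpow[OF Dk i, of k k] by (simp add: W_def)
  have "((X i \<circ> D i) ^^ Suc n) f = (X i \<circ> D i) (\<lambda>x. \<Sum>k\<le>n. real (Stirling n k) * W k x)"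
    unfolding funpow.simps comp_apply[of "X i \<circ> D i"] Suc W_def ..
  also have "\<dots> = (\<lambda>x. \<Sum>k\<le>n. real (Stirling n k) * (real k * W k x + W (Suc k) x))"
    by (subst linear_op_sum[OF XD]) (simp_all add: W step del: comp_apply)
  also have "\<dots> = (\<lambda>x. \<Sum>k\<le>Suc n. real (Stirling (Suc n) k) * W k x)"
  proof
    fix x
    \<comment> \<open>The added term vanishes because \<open>Stirling n (Suc n) = 0\<close>; the
      shift that follows drops the term \<open>k = 0\<close>, which has the factor
      \<open>k\<close>.\<close>
    have "(\<Sum>k\<le>n. real (Stirling n k) * (real k * W k x)) =
        (\<Sum>k\<le>Suc n. real (Stirling n k) * (real k * W k x))"
      by simp
    also have "\<dots> = (\<Sum>k\<le>n. real (Stirling n (Suc k)) * (real (Suc k) * W (Suc k) x))"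
      by (subst sum.atMost_Suc_shift) simp
    finally show "(\<Sum>k\<le>n. real (Stirling n k) * (real k * W k x + W (Suc k) x)) =
        (\<Sum>k\<le>Suc n. real (Stirling (Suc n) k) * W k x)"
      by (subst sum.atMost_Suc_shift) (simp add: algebra_simps sum.distrib)
  qed
  finally show ?case
    unfolding W_def .
qed simp

section \<open>Recovering base-\<open>b\<close> digits\<close>

lemma sum_digits_less:
  fixes b :: nat
  assumes "\<And>i. i < N \<Longrightarrow> k i < b"
  shows "(\<Sum>i<N. k i * b ^ i) < b ^ N"
  using assms
proof (induction N)
  case (Suc N)
  have "(\<Sum>i<Suc N. k i * b ^ i) < b ^ N + k N * b ^ N"
    using Suc by simp
  also have "\<dots> = Suc (k N) * b ^ N"
    by simp
  also have "\<dots> \<le> b ^ Suc N"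
    using Suc.prems[of N] by (simp only: power_Suc mult_le_mono1 lessI Suc_leI)
  finally show ?case .
qed simp

lemma digit_of_sum:
  fixes b :: nat
  assumes "\<And>i. i < N \<Longrightarrow> k i < b" "j < N"
  shows "(\<Sum>i<N. k i * b ^ i) div b ^ j mod b = k j"
  using assms
proof (induction N)
  case (Suc N)
  have b: "b > 0"
    using Suc.prems(1)[of j] Suc.prems(2) by simp
  have less: "(\<Sum>i<N. k i * b ^ i) < b ^ N"
    using Suc.prems by (intro sum_digits_less) auto
  show ?case
  proof (cases "j = N")
    case True
    then show ?thesis
      using less b Suc.prems(1)[of N] by simp
  next
    case False
    then have j: "j < N"
      using Suc.prems by simp
    then obtain m where m: "N = j + Suc m"
      by (auto dest: less_imp_Suc_add)
    \<comment> \<open>For \<open>j < N\<close> the new leading term is a multiple of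
      \<open>b * b ^ j\<close>: after division by \<open>b ^ j\<close> it vanishes modulo
      \<open>b\<close>.\<close>
    have "(\<Sum>i<Suc N. k i * b ^ i) = (\<Sum>i<N. k i * b ^ i) + (k N * b ^ m * b) * b ^ j"
      by (simp add: m power_add mult_ac)
    then have "(\<Sum>i<Suc N. k i * b ^ i) div b ^ j = k N * b ^ m * b + (\<Sum>i<N. k i * b ^ i) div b ^ j"
      using b div_mult_self1[of "b ^ j" "\<Sum>i<N. k i * b ^ i" "k N * b ^ m * b"]
      by (metis less_not_refl power_eq_0_iff)
    then show ?thesis
      using Suc.IH Suc.prems j by (simp only: mod_mult_self3)
  qed
qed simp

text \<open>From \<open>n < b\<close> each \<open>k i \<le> n\<close> is a genuine digit, so the sum
  encodes \<open>k\<close> without carries.\<close>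

lemma base_Stirling_digits:
  assumes "k \<in> {..<N} \<rightarrow>\<^sub>E {0..n}" "n < b"
  shows "base_Stirling N b n (\<Sum>i<N. k i * b ^ i) = (\<Prod>i<N. Stirling n (k i))"
proof -
  have "k i < b" if "i < N" for i
    using assms that by (force simp: PiE_def Pi_def)
  then show ?thesis
    by (simp add: base_Stirling_def digit_of_sum)
qed

section \<open>Expanding the powers of \<open>vartheta\<close>\<close>

text \<open>\<open>X i\<close> and \<open>D j\<close> commute for \<open>i \<noteq> j\<close>, which
  lets each \<open>X i\<close> be paired with its own \<open>D i\<close>.\<close>

lemma vartheta_eq_op_prod:
  assumes "f \<in> smooth_functions N"
  shows "vartheta N f = op_prod N (\<lambda>i. X i \<circ> D i) f"
  unfolding vartheta_def comp_apply
  by (subst op_prod_op_prod[where N = N])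
     (auto simp: assms linear_op_X linear_op_D D_X comp_def)

theorem theorem8:
  fixes N n b :: nat
  assumes "N \<ge> 1" and "b \<ge> 2" and "b > n"
  shows "\<forall>f \<in> smooth_functions N.
    (vartheta N ^^ n) f =
      (\<lambda>x. \<Sum>k \<in> {..<N} \<rightarrow>\<^sub>E {0..n}.
         real (base_Stirling N b n (\<Sum>i<N. k i * b ^ i)) *
         op_prod N (\<lambda>i. (X i ^^ k i) \<circ> (D i ^^ k i)) f x)"
proof
  fix f
  assume f: "f \<in> smooth_functions N"
  let ?P = "op_prod N (\<lambda>i. X i \<circ> D i)"
  have XD: "linear_op N (X i \<circ> D i)" if "i < N" for i
    by (intro linear_op_comp linear_op_X linear_op_D that)
  \<comment> \<open>All four pairs of factors commute for distinct indices; the pair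
    \<open>D i\<close>, \<open>D j\<close> needs Schwarz's theorem.\<close>
  have comm: "(X i \<circ> D i) ((X j \<circ> D j) g) = (X j \<circ> D j) ((X i \<circ> D i) g)"
    if "i < N" "j < N" "i \<noteq> j" "g \<in> smooth_functions N" for i j g
    using that
    by (simp add: D_X[of _ N] smooth_functions_D D_D_commute[of g N i j] X_X_commute[of i j])
  \<comment> \<open>\<open>vartheta N\<close> and \<open>?P\<close> are known to agree only on
    smooth functions, so replacing one by the other under iteration requires smooth
    iterates.\<close>
  have P: "(?P ^^ m) f \<in> smooth_functions N" for m
    by (intro linear_op_smooth[OF linear_op_funpow] linear_op_op_prod XD f)
  have "(vartheta N ^^ n) f = (?P ^^ n) f"
  proof (induction n)
    case (Suc n)
    then show ?case
      using vartheta_eq_op_prod[OF P, of n] by (simp add: comp_def)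
  qed simp
  also have "\<dots> = op_prod N (\<lambda>i. (X i \<circ> D i) ^^ n) f"
    using XD comm f by (rule op_prod_funpow)
  also have "\<dots> = (\<lambda>x. \<Sum>k \<in> {..<N} \<rightarrow>\<^sub>E {0..n}. (\<Prod>i<N. real (Stirling n (k i))) *
      op_prod N (\<lambda>i. (X i ^^ k i) \<circ> (D i ^^ k i)) f x)"
  proof (rule op_prod_sum)
    show "linear_op N ((X i ^^ k) \<circ> (D i ^^ k))" if "i < N" for i k
      by (intro linear_op_comp linear_op_funpow linear_op_X linear_op_D that)
    show "((X i \<circ> D i) ^^ n) g =
        (\<lambda>x. \<Sum>k\<in>{0..n}. real (Stirling n k) * ((X i ^^ k) \<circ> (D i ^^ k)) g x)"
      if "i < N" "g \<in> smooth_functions N" for i g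
      using X_D_funpow[OF that(2,1)] unfolding atMost_atLeast0 .
  qed (use f in simp_all)
  also have "\<dots> = (\<lambda>x. \<Sum>k \<in> {..<N} \<rightarrow>\<^sub>E {0..n}.
         real (base_Stirling N b n (\<Sum>i<N. k i * b ^ i)) *
         op_prod N (\<lambda>i. (X i ^^ k i) \<circ> (D i ^^ k i)) f x)"
    by (intro ext sum.cong) (simp_all add: base_Stirling_digits assms(3))
  finally show "(vartheta N ^^ n) f = (\<lambda>x. \<Sum>k \<in> {..<N} \<rightarrow>\<^sub>E {0..n}.
         real (base_Stirling N b n (\<Sum>i<N. k i * b ^ i)) *
         op_prod N (\<lambda>i. (X i ^^ k i) \<circ> (D i ^^ k i)) f x)" .
qed

end
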